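(* For $|q|<1$, \begin{align*} \sum_{i,j,k\geq 0}\frac{q^{2i^2+j^2+k^2+2ij+2ik+k}}{(q^2;q^2)_i(q^2;q^2)_j(q^2;q^2)_k}&=\frac{(q^3,q^4,q^7;q^7)_\infty}{(q;q)_\infty}, \\ \sum_{i,j,k\geq 0} \frac{q^{2i^2+j^2+k^2+2ij+2ik+2i+j}}{(q^2;q^2)_i(q^2;q^2)_j(q^2;q^2)_k}&=\frac{(q^2,q^5,q^7;q^7)_\infty}{(q;q)_\infty}, \\ \sum_{i,j,k\geq 0} \frac{q^{2i^2+j^2+k^2+2ij+2ik+2i+j+2k}}{(q^2;q^2)_i(q^2;q^2)_j(q^2;q^2)_k}&=\frac{(q,q^6,q^7;q^7)_\infty}{(q;q)_\infty}. \end{align*}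
   Context: For $|q|<1$: $(a;q)_n=\prod_{k=0}^{n-1}(1-aq^k)$ ($(a;q)_0=1$), $(a;q)_\infty=\prod_{k\ge0}(1-aq^k)$, $(a_1,\dots,a_m;q)_\infty=\prod_\ell(a_\ell;q)_\infty$. *)

theory Defs
  imports "HOL-Analysis.Analysis"
begin

definition qpoch :: "complex \<Rightarrow> complex \<Rightarrow> nat \<Rightarrow> complex" where
  "qpoch a q n = (\<Prod>k<n. (1 - a * q ^ k))"

definition qpoch_inf :: "complex \<Rightarrow> complex \<Rightarrow> complex" where
  "qpoch_inf a q = (\<Prod>k. (1 - a * q ^ k))"

end

theory Submission
  imports Defs
begin

text \<open>
  The exponent is \<open>(i + j)\<^sup>2 + (i + k)\<^sup>2\<close> plus a linear form, so Euler's expansion sums over \<open>j\<close>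
  and \<open>k\<close> and leaves a multiple of one of the Rogers--Selberg sums
  \<open>\<Sum>\<^sub>n q^(2n\<^sup>2) / ((q\<^sup>2;q\<^sup>2)\<^sub>n (-q;q)\<^sub>2\<^sub>n)\<close> and its two companions.

  Write \<open>Q = q\<^sup>2\<close>, \<open>g k = 1 / (Q;Q)\<^sub>k\<close>, and let \<open>A\<^sub>n(e)\<close> and \<open>B\<^sub>n(e)\<close> be the sums over all integers
  \<open>r\<close> of \<open>(-1)^r q^(r(3r+1)/2 + er)\<close> times \<open>g(n-r) g(n+r)\<close> and \<open>g(n-r) g(n+r+1)\<close>, respectively. The
  \<open>q\<close>-Pascal rule gives
  \<open>(1 - Q^(2n+1)) B\<^sub>n(e) = A\<^sub>n(e) - q^(2n+1-e) A\<^sub>n(e-1)\<close> and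
  \<open>(1 - Q^(2n+2)) A\<^sub>n\<^sub>+\<^sub>1(e) = B\<^sub>n(e) - q^(2n+2+e) B\<^sub>n(e+1)\<close>, while reflecting \<open>r\<close> gives
  \<open>A\<^sub>n(e) = A\<^sub>n(-1-e)\<close> and \<open>B\<^sub>n(1) = 0\<close>. These relations evaluate \<open>A\<^sub>n(0)\<close>, \<open>B\<^sub>n(-1)\<close> and \<open>B\<^sub>n(0)\<close>
  as exactly the coefficients of the three Rogers--Selberg sums. Interchanging the summations over
  \<open>n\<close> and \<open>r\<close> and applying Cauchy's identity
  \<open>\<Sum>\<^sub>m Q^(m(m+s)) g(m) g(m+s) = 1 / (Q;Q)\<^sub>\<infinity>\<close> leaves a theta series, evaluated by Jacobi's triple
  product, which itself is the product of two Euler expansions regrouped by Cauchy's identity.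
\<close>

section \<open>Absolutely convergent sums over product sets\<close>

lemma summable_on_norm_mult_Times:
  fixes f :: "'a \<Rightarrow> complex" and g :: "'b \<Rightarrow> complex"
  assumes "(\<lambda>x. norm (f x)) summable_on A" "(\<lambda>y. norm (g y)) summable_on B"
  shows "(\<lambda>p. norm (f (fst p) * g (snd p))) summable_on A \<times> B"
proof (rule summable_on_SigmaI[where g = "\<lambda>x. norm (f x) * infsum (\<lambda>y. norm (g y)) B"])
  fix x
  show "((\<lambda>y. norm (f (fst (x, y)) * g (snd (x, y)))) has_sum norm (f x) * infsum (\<lambda>y. norm (g y)) B) B"
    using has_sum_cmult_right[OF has_sum_infsum[OF assms(2)], of "norm (f x)"]
    by (simp add: norm_mult)
next
  show "(\<lambda>x. norm (f x) * infsum (\<lambda>y. norm (g y)) B) summable_on A"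
    using assms(1) by (rule summable_on_cmult_left)
qed auto

lemma has_sum_mult_Times:
  fixes f :: "'a \<Rightarrow> complex" and g :: "'b \<Rightarrow> complex"
  assumes "(\<lambda>x. norm (f x)) summable_on A" "(\<lambda>y. norm (g y)) summable_on B"
    and "(f has_sum F) A" "(g has_sum G) B"
  shows "((\<lambda>p. f (fst p) * g (snd p)) has_sum F * G) (A \<times> B)"
proof (rule has_sum_SigmaI[where g = "\<lambda>x. f x * G"])
  show "(\<lambda>p. f (fst p) * g (snd p)) summable_on A \<times> B"
    by (rule abs_summable_summable[OF summable_on_norm_mult_Times[OF assms(1,2)]])
  show "((\<lambda>x. f x * G) has_sum F * G) A"
    using assms(3) by (rule has_sum_cmult_left)
qed (use has_sum_cmult_right[OF assms(4)] in auto)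

lemma summable_on_nat_norm_iff:
  fixes f :: "nat \<Rightarrow> complex"
  shows "(\<lambda>n. norm (f n)) summable_on UNIV \<longleftrightarrow> summable (\<lambda>n. norm (f n))"
  by (simp add: summable_on_UNIV_nonneg_real_iff)

lemma has_sum_sums_iff:
  fixes f :: "nat \<Rightarrow> complex"
  assumes "summable (\<lambda>n. norm (f n))"
  shows "(f has_sum S) UNIV \<longleftrightarrow> f sums S"
  using assms has_sum_imp_sums norm_summable_imp_has_sum by blast

section \<open>q-Pochhammer symbols\<close>

lemma qpoch_0 [simp]: "qpoch a q 0 = 1"
  by (simp add: qpoch_def)

lemma qpoch_Suc: "qpoch a q (Suc n) = qpoch a q n * (1 - a * q ^ n)"
  by (simp add: qpoch_def)

lemma qpoch_add: "qpoch a q (m + n) = qpoch a q m * qpoch (a * q ^ m) q n"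
  by (induction n) (simp_all add: qpoch_Suc power_add mult_ac)

lemma convergent_prod_qpoch:
  fixes a q :: complex
  assumes "norm q < 1"
  shows "convergent_prod (\<lambda>k. 1 - a * q ^ k)"
proof (rule abs_convergent_prod_imp_convergent_prod, rule summable_imp_abs_convergent_prod)
  show "summable (\<lambda>i. norm (1 - a * q ^ i - 1))"
    using assms by (auto simp: norm_mult norm_power intro!: summable_mult summable_geometric)
qed

lemma qpoch_tendsto:
  assumes "norm q < 1"
  shows "qpoch a q \<longlonglongrightarrow> qpoch_inf a q"
proof -
  have "(\<lambda>n. qpoch a q (Suc n)) \<longlonglongrightarrow> qpoch_inf a q"
    using convergent_prod_LIMSEQ[OF convergent_prod_qpoch[OF assms, of a]]
    by (simp add: qpoch_def qpoch_inf_def lessThan_Suc_atMost)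
  thus ?thesis by (rule LIMSEQ_imp_Suc)
qed

lemma qpoch_inf_split:
  assumes "norm q < 1"
  shows "qpoch_inf a q = qpoch a q n * qpoch_inf (a * q ^ n) q"
proof (rule LIMSEQ_unique)
  show "(\<lambda>m. qpoch a q (n + m)) \<longlonglongrightarrow> qpoch_inf a q"
    using qpoch_tendsto[OF assms] by (simp add: LIMSEQ_ignore_initial_segment add.commute[of n])
  show "(\<lambda>m. qpoch a q (n + m)) \<longlonglongrightarrow> qpoch a q n * qpoch_inf (a * q ^ n) q"
    unfolding qpoch_add by (intro tendsto_mult tendsto_const qpoch_tendsto assms)
qed

lemma qpoch_square_split: "qpoch a q (2 * n) = qpoch a (q^2) n * qpoch (a * q) (q^2) n"
  by (induction n) (simp_all add: qpoch_Suc power_mult mult_ac power2_eq_square power_mult_distrib)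

lemma qpoch_inf_square_split:
  assumes "norm q < 1"
  shows "qpoch_inf a q = qpoch_inf a (q^2) * qpoch_inf (a * q) (q^2)"
proof (rule LIMSEQ_unique)
  have q2: "norm (q^2) < 1"
    using assms by (simp add: norm_power power_less_one_iff)
  have "strict_mono (\<lambda>n::nat. 2 * n)"
    by (simp add: strict_mono_def)
  from LIMSEQ_subseq_LIMSEQ[OF qpoch_tendsto[OF assms] this]
  show "(\<lambda>n. qpoch a q (2 * n)) \<longlonglongrightarrow> qpoch_inf a q"
    by (simp add: o_def)
  show "(\<lambda>n. qpoch a q (2 * n)) \<longlonglongrightarrow> qpoch_inf a (q^2) * qpoch_inf (a * q) (q^2)"
    unfolding qpoch_square_split by (intro tendsto_mult qpoch_tendsto q2)
qed

lemma qpoch_inf_uminus: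
  assumes "norm q < 1"
  shows "qpoch_inf a q * qpoch_inf (-a) q = qpoch_inf (a^2) (q^2)"
proof (rule LIMSEQ_unique)
  have q2: "norm (q^2) < 1"
    using assms by (simp add: norm_power power_less_one_iff)
  have "qpoch a q n * qpoch (-a) q n = qpoch (a^2) (q^2) n" for n
    unfolding qpoch_def prod.distrib[symmetric]
    by (rule prod.cong) (simp_all add: algebra_simps power2_eq_square power_mult_distrib)
  moreover have "(\<lambda>n. qpoch a q n * qpoch (-a) q n) \<longlonglongrightarrow> qpoch_inf a q * qpoch_inf (-a) q"
    by (intro tendsto_mult qpoch_tendsto assms)
  ultimately show "qpoch (a^2) (q^2) \<longlonglongrightarrow> qpoch_inf a q * qpoch_inf (-a) q"
    by simp
  show "qpoch (a^2) (q^2) \<longlonglongrightarrow> qpoch_inf (a^2) (q^2)"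
    by (rule qpoch_tendsto[OF q2])
qed

lemma one_minus_power_neq_0:
  fixes q :: complex
  assumes "norm q < 1"
  shows "1 - q ^ Suc n \<noteq> 0"
proof
  assume "1 - q ^ Suc n = 0"
  hence "norm q ^ Suc n = 1"
    by (metis norm_power norm_one right_minus_eq)
  thus False
    using assms power_Suc_less_one[of "norm q" n] by (cases "q = 0") auto
qed

lemma one_plus_power_neq_0:
  fixes q :: complex
  assumes "norm q < 1"
  shows "1 + q ^ Suc n \<noteq> 0"
proof
  assume "1 + q ^ Suc n = 0"
  hence "norm (q ^ Suc n) = norm (-1::complex)"
    by (metis add_eq_0_iff)
  hence "norm q ^ Suc n = 1" by (simp add: norm_power norm_mult)
  thus False
    using assms power_Suc_less_one[of "norm q" n] by (cases "q = 0") auto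
qed

lemma qpoch_self_neq_0: "norm q < 1 \<Longrightarrow> qpoch q q n \<noteq> 0"
  using one_minus_power_neq_0[of q] by (simp add: qpoch_def)

lemma qpoch_uminus_self_neq_0: "norm q < 1 \<Longrightarrow> qpoch (-q) q n \<noteq> 0"
  using one_plus_power_neq_0[of q] by (simp add: qpoch_def)

lemma qpoch_inf_self_neq_0: "norm q < 1 \<Longrightarrow> qpoch_inf q q \<noteq> 0"
  unfolding qpoch_inf_def using one_minus_power_neq_0[of q]
  by (intro prodinf_nonzero convergent_prod_qpoch) auto

text \<open>The reciprocals converge because \<open>(q;q)_inf\<close> is nonzero. The bound feeds
  the dominating families in Cauchy's identity, in the interchange over \<open>n\<close> and
  \<open>r\<close>, and in the triple sum.\<close>

lemma inverse_qpoch_bounded: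
  assumes "norm q < 1"
  obtains C where "C > 0" "\<And>n. norm (1 / qpoch q q n) \<le> C"
proof -
  have "(\<lambda>n. 1 / qpoch q q n) \<longlonglongrightarrow> 1 / qpoch_inf q q"
    by (intro tendsto_divide tendsto_const qpoch_tendsto qpoch_inf_self_neq_0 assms)
  hence "Bseq (\<lambda>n. 1 / qpoch q q n)"
    by (rule convergent_imp_Bseq[OF convergentI])
  thus ?thesis using that by (auto elim!: BseqE)
qed

section \<open>Euler's expansion\<close>

text \<open>The coefficient of \<open>x^n\<close> in the expansion of
  \<open>(-x;q)_inf\<close>.\<close>

definition euler_coeff :: "complex \<Rightarrow> nat \<Rightarrow> complex" where
  "euler_coeff q n = q ^ (n choose 2) / qpoch q q n"

lemma euler_coeff_Suc: 
  assumes "norm q < 1"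
  shows "(1 - q ^ Suc n) * euler_coeff q (Suc n) = q ^ n * euler_coeff q n"
proof -
  have "Suc n choose 2 = n + (n choose 2)"
    by (simp add: numeral_2_eq_2)
  thus ?thesis using one_minus_power_neq_0[OF assms, of n] qpoch_self_neq_0[OF assms, of n]
    by (simp add: euler_coeff_def qpoch_Suc power_add field_simps)
qed

text \<open>Consecutive terms have ratio \<open>q^n * x / (1 - q^(n+1))\<close>, which tends to 0,
  so the series converges for every \<open>x\<close>.\<close>

lemma summable_norm_euler:
  assumes "norm q < 1"
  shows "summable (\<lambda>n. norm (euler_coeff q n * x ^ n))"
proof -
  have "(\<lambda>n. q ^ n * x / (1 - q ^ Suc n)) \<longlonglongrightarrow> 0 * x / (1 - 0)"
    using assms by (intro tendsto_intros LIMSEQ_power_zero LIMSEQ_Suc) auto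
  hence "(\<lambda>n. norm (q ^ n * x / (1 - q ^ Suc n))) \<longlonglongrightarrow> 0"
    by (simp add: tendsto_norm_zero_iff)
  hence "eventually (\<lambda>n. norm (q ^ n * x / (1 - q ^ Suc n)) < 1/2) sequentially"
    by (rule order_tendstoD) simp
  then obtain N where N: "\<And>n. n \<ge> N \<Longrightarrow> norm (q ^ n * x / (1 - q ^ Suc n)) < 1/2"
    by (auto simp: eventually_sequentially)
  show ?thesis
  proof (rule summable_ratio_test[of "1/2" N])
    fix n assume n: "n \<ge> N"
    have "euler_coeff q (Suc n) * x ^ Suc n
            = (q ^ n * x / (1 - q ^ Suc n)) * (euler_coeff q n * x ^ n)"
    proof -
      have "euler_coeff q (Suc n) = q ^ n * euler_coeff q n / (1 - q ^ Suc n)"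
        using euler_coeff_Suc[OF assms, of n] one_minus_power_neq_0[OF assms, of n]
        by (simp add: nonzero_eq_divide_eq mult.commute)
      thus ?thesis by simp
    qed
    hence "norm (euler_coeff q (Suc n) * x ^ Suc n)
            = norm (q ^ n * x / (1 - q ^ Suc n)) * norm (euler_coeff q n * x ^ n)"
      by (simp only: norm_mult)
    also have "\<dots> \<le> 1/2 * norm (euler_coeff q n * x ^ n)"
      using N[OF n] by (intro mult_right_mono) auto
    finally show "norm (norm (euler_coeff q (Suc n) * x ^ Suc n))
                    \<le> 1/2 * norm (norm (euler_coeff q n * x ^ n))" by simp
  qed simp
qed

text \<open>The series satisfies \<open>f x = (1 + x) * f (x * q)\<close>. Iteration moves the
  argument to \<open>x * q ^ n\<close>, which tends to 0, and continuity at 0 together with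
  \<open>f 0 = 1\<close> leaves the infinite product.\<close>

lemma euler_sums:
  assumes q: "norm q < 1"
  shows "(\<lambda>n. euler_coeff q n * x ^ n) sums qpoch_inf (-x) q"
proof -
  define f where "f x = (\<Sum>n. euler_coeff q n * x ^ n)" for x
  have summ: "summable (\<lambda>n. euler_coeff q n * x ^ n)" for x
    using summable_norm_euler[OF q] by (rule summable_norm_cancel)
  have rec: "f x = (1 + x) * f (x * q)" for x
  proof -
    have "f x - f (x * q) = (\<Sum>n. euler_coeff q n * x ^ n - euler_coeff q n * (x * q) ^ n)"
      unfolding f_def by (rule suminf_diff[OF summ summ])
    also have "\<dots> = (\<Sum>n. (1 - q ^ n) * euler_coeff q n * x ^ n)"
      by (simp add: algebra_simps power_mult_distrib)
    \<comment> \<open>The term \<open>n = 0\<close> carries the factor \<open>1 - q^0 = 0\<close>,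
      so the index can be shifted and the coefficient recurrence applied.\<close>
    also have "\<dots> = (\<Sum>n. (1 - q ^ Suc n) * euler_coeff q (Suc n) * x ^ Suc n)"
    proof (subst suminf_split_head)
      have "summable (\<lambda>n. euler_coeff q n * x ^ n - euler_coeff q n * (x * q) ^ n)"
        by (rule summable_diff[OF summ summ])
      thus "summable (\<lambda>n. (1 - q ^ n) * euler_coeff q n * x ^ n)"
        by (simp add: algebra_simps power_mult_distrib)
    qed simp
    also have "\<dots> = (\<Sum>n. x * (euler_coeff q n * (x * q) ^ n))"
      unfolding euler_coeff_Suc[OF q] by (simp add: algebra_simps power_mult_distrib)
    also have "\<dots> = x * f (x * q)"
      unfolding f_def by (rule suminf_mult[OF summ])
    finally show ?thesis by (simp add: algebra_simps)
  qed
  have iter: "f x = qpoch (-x) q n * f (x * q ^ n)" for n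
    by (induction n) (use rec[of "x * q ^ n" for n] in \<open>auto simp: qpoch_Suc algebra_simps\<close>)
  have "isCont f 0"
    unfolding f_def by (rule isCont_powser[OF summ[of 1]]) simp
  moreover have "(\<lambda>n. x * q ^ n) \<longlonglongrightarrow> 0"
    using tendsto_mult[OF tendsto_const LIMSEQ_power_zero[OF q], of x] by simp
  ultimately have "(\<lambda>n. f (x * q ^ n)) \<longlonglongrightarrow> f 0"
    by (rule isCont_tendsto_compose)
  hence "(\<lambda>n. qpoch (-x) q n * f (x * q ^ n)) \<longlonglongrightarrow> qpoch_inf (-x) q * f 0"
    by (intro tendsto_mult qpoch_tendsto q)
  hence "f x = qpoch_inf (-x) q * f 0"
    unfolding iter[symmetric] by (simp add: LIMSEQ_const_iff)
  moreover have "f 0 = 1"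
    unfolding f_def powser_zero by (simp add: euler_coeff_def numeral_2_eq_2)
  ultimately show ?thesis
    using summable_sums[OF summ, of x] by (simp add: f_def)
qed

section \<open>Cauchy's identity\<close>

text \<open>The value is independent of \<open>s\<close>, so it can be found by letting
  \<open>s\<close> tend to infinity: only the term \<open>m = 0\<close> survives, and it tends to
  \<open>1 / (q;q)_inf\<close>.\<close>

lemma cauchy_sums:
  fixes q :: complex
  assumes q: "norm q < 1"
  shows "summable (\<lambda>m. norm (q ^ (m * (m + s)) / (qpoch q q m * qpoch q q (m + s))))" (is ?th1)
    and "(\<lambda>m. q ^ (m * (m + s)) / (qpoch q q m * qpoch q q (m + s))) sums (1 / qpoch_inf q q)" (is ?th2)
proof -
  define t where "t s m = q ^ (m * (m + s)) / (qpoch q q m * qpoch q q (m + s))" for s m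
  define f where "f s = (\<Sum>m. t s m)" for s
  obtain C where C: "C > 0" "\<And>n. norm (1 / qpoch q q n) \<le> C"
    using inverse_qpoch_bounded[OF q] by blast
  have bound: "norm (t s m) \<le> C * C * norm q ^ m" for s m
  proof -
    have "norm (t s m) = norm q ^ (m * (m + s)) * norm (1 / qpoch q q m) * norm (1 / qpoch q q (m + s))"
      by (simp add: t_def norm_divide norm_mult norm_power)
    also have "\<dots> \<le> norm q ^ m * C * C"
      using C q by (intro mult_mono power_decreasing) auto
    finally show ?thesis by (simp add: mult_ac)
  qed
  have summ_norm: "summable (\<lambda>m. norm (t s m))" for s
  proof (rule summable_comparison_test'[where N = 0])
    show "summable (\<lambda>m. C * C * norm q ^ m)"
      using q by (intro summable_mult summable_geometric) auto
  qed (use bound in auto)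
  have summ: "summable (t s)" for s
    using summ_norm by (rule summable_norm_cancel)
  have lim: "f \<longlonglongrightarrow> 1 / qpoch_inf q q"
  proof -
    have "((\<lambda>s. \<Sum>m. t s m) \<longlongrightarrow> (\<Sum>m. if m = 0 then 1 / qpoch_inf q q else 0)) sequentially"
    proof (rule tannerys_theorem[THEN conjunct2, THEN conjunct2])
      show "((\<lambda>s. t s m) \<longlongrightarrow> (if m = 0 then 1 / qpoch_inf q q else 0)) sequentially" for m
      proof (cases "m = 0")
        case True
        thus ?thesis using q
          by (auto simp: t_def intro!: tendsto_intros qpoch_tendsto qpoch_inf_self_neq_0)
      next
        case False
        have "(\<lambda>s. q ^ (m * m) * ((q ^ m) ^ s) / (qpoch q q m * qpoch q q (s + m)))
              \<longlonglongrightarrow> q ^ (m * m) * 0 / (qpoch q q m * qpoch_inf q q)"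
          using q False qpoch_inf_self_neq_0[OF q] qpoch_self_neq_0[OF q, of m]
          by (intro tendsto_intros LIMSEQ_power_zero LIMSEQ_ignore_initial_segment qpoch_tendsto)
             (auto simp: norm_power power_less_one_iff)
        thus ?thesis using False
          by (simp add: t_def algebra_simps power_add flip: power_mult)
      qed
      show "eventually (\<lambda>(m,s). norm (t s m) \<le> C * C * norm q ^ m) (at_top \<times>\<^sub>F sequentially)"
        using bound by (intro always_eventually) auto
      show "summable (\<lambda>m. C * C * norm q ^ m)"
        using q by (intro summable_mult summable_geometric) auto
    qed simp
    moreover have "(\<Sum>m. if m = 0 then 1 / qpoch_inf q q else 0) = 1 / qpoch_inf q q"
      by (subst suminf_finite[of "{0}"]) auto
    ultimately show ?thesis by (simp add: f_def[abs_def])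
  qed
  \<comment> \<open>The differences of \<open>f\<close> shrink when going from \<open>Suc s\<close> to \<open>s\<close>, yet tend to 0: they vanish.\<close>
  have rec: "f s - f (Suc s) = - (q ^ Suc s) * (f (Suc s) - f (Suc (Suc s)))" for s
  proof -
    \<comment> \<open>\<open>u\<close> has two readings: expanding \<open>1 - q ^ m\<close> gives a
      combination of the summands of \<open>f s\<close> and \<open>f (Suc s)\<close>, while
      cancelling it against \<open>qpoch q q m\<close> and shifting \<open>m\<close> gives a
      multiple of the summand of \<open>f (Suc (Suc s))\<close>.\<close>
    define u where "u m = q ^ (m * (m + s)) * (1 - q ^ m) / (qpoch q q m * qpoch q q (m + s + 1))" for m
    have nz [simp]: "qpoch q q n \<noteq> 0" "q * q ^ n \<noteq> 1" for n
      using qpoch_self_neq_0[OF q, of n] one_minus_power_neq_0[OF q, of n] by auto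
    have u_eq: "u m = t s m - t (Suc s) m + q ^ Suc s * t (Suc s) m" for m
    proof -
      have "t s m = q ^ (m * (m + s)) * (1 - q * q ^ (m + s)) / (qpoch q q m * qpoch q q (m + s + 1))"
        by (simp add: t_def qpoch_Suc)
      moreover have "t (Suc s) m = q ^ (m * (m + s)) * q ^ m / (qpoch q q m * qpoch q q (m + s + 1))"
        by (simp add: t_def power_add)
      ultimately show ?thesis
        by (simp add: u_def add_divide_distrib[symmetric] diff_divide_distrib[symmetric] power_add algebra_simps del: power_Suc)
          (simp add: algebra_simps)
    qed
    have u_Suc: "u (Suc m) = q ^ Suc s * t (Suc (Suc s)) m" for m
    proof -
      have "Suc m * (Suc m + s) = Suc s + m * (m + Suc (Suc s))" by (simp add: algebra_simps)
      thus ?thesis unfolding u_def t_def by (simp add: qpoch_Suc power_add mult_ac)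
    qed
    have u_sum: "summable u"
      unfolding u_eq[abs_def] by (intro summable_add summable_diff summ summable_mult)
    have "f s - f (Suc s) + q ^ Suc s * f (Suc s) = suminf u"
      unfolding u_eq[abs_def] f_def
      by (simp add: suminf_add[symmetric] suminf_diff[symmetric] suminf_mult summ summable_diff summable_mult)
    also have "\<dots> = (\<Sum>m. u (Suc m))"
      by (subst suminf_split_head[OF u_sum]) (simp add: u_def)
    also have "\<dots> = q ^ Suc s * f (Suc (Suc s))"
      unfolding u_Suc f_def by (rule suminf_mult[OF summ])
    finally show ?thesis by (simp add: algebra_simps)
  qed
  define d where "d s = norm (f s - f (Suc s))" for s
  have "d s \<le> d (Suc s)" for s
  proof -
    have "d s = norm q ^ Suc s * d (Suc s)"
      unfolding d_def by (subst rec) (simp add: norm_mult norm_power)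
    also have "\<dots> \<le> 1 * d (Suc s)"
      using q by (intro mult_right_mono power_le_one) (auto simp: d_def)
    finally show ?thesis by simp
  qed
  hence "incseq d" by (rule incseq_SucI)
  moreover have "d \<longlonglongrightarrow> 0"
    using tendsto_norm[OF tendsto_diff[OF lim LIMSEQ_Suc[OF lim]]] by (simp add: d_def[abs_def])
  ultimately have "d s \<le> 0" for s by (rule incseq_le)
  hence step: "f (Suc s) = f s" for s by (simp add: d_def)
  have const: "f s = f 0" for s by (induction s) (simp_all add: step)
  have "(\<lambda>s. f 0) \<longlonglongrightarrow> 1 / qpoch_inf q q"
    by (rule Lim_transform_eventually[OF lim]) (auto intro: always_eventually const)
  hence "f 0 = 1 / qpoch_inf q q" by (simp add: LIMSEQ_const_iff)
  hence "f s = 1 / qpoch_inf q q" using const[of s] by (rule trans[rotated])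
  thus ?th1 ?th2
    using summ_norm[of s] summable_sums[OF summ[of s]] by (simp_all add: f_def t_def[abs_def])
qed

section \<open>Sums over the integers\<close>

lemma has_sum_int_shift:
  fixes f :: "int \<Rightarrow> 'a :: {comm_monoid_add, topological_space}"
  shows "((\<lambda>m. f (m + c)) has_sum S) UNIV \<longleftrightarrow> (f has_sum S) UNIV"
  by (rule has_sum_reindex_bij_betw, rule bij_betwI[of _ _ _ "\<lambda>m. m - c"]) auto

lemma has_sum_int_reflect:
  fixes f :: "int \<Rightarrow> 'a :: {comm_monoid_add, topological_space}"
  shows "((\<lambda>m. f (c - m)) has_sum S) UNIV \<longleftrightarrow> (f has_sum S) UNIV"
  by (rule has_sum_reindex_bij_betw, rule bij_betwI[of _ _ _ "\<lambda>m. c - m"]) auto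

lemma has_sum_int_nonneg:
  fixes f :: "int \<Rightarrow> 'a :: {comm_monoid_add, topological_space}"
  assumes "\<And>k. k < 0 \<Longrightarrow> f k = 0"
  shows "(f has_sum S) UNIV \<longleftrightarrow> ((\<lambda>n. f (int n)) has_sum S) UNIV"
proof -
  have "((\<lambda>n. f (int n)) has_sum S) UNIV \<longleftrightarrow> (f has_sum S) {0..}"
    by (rule has_sum_reindex_bij_betw, rule bij_betwI[of _ _ _ nat]) auto
  also have "\<dots> \<longleftrightarrow> (f has_sum S) UNIV"
    by (rule has_sum_cong_neutral) (use assms in auto)
  finally show ?thesis by simp
qed

lemma summable_on_int_nonneg:
  fixes f :: "int \<Rightarrow> 'a :: {comm_monoid_add, topological_space}"
  assumes "\<And>k. k < 0 \<Longrightarrow> f k = 0"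
  shows "f summable_on UNIV \<longleftrightarrow> (\<lambda>n. f (int n)) summable_on UNIV"
  unfolding summable_on_def using has_sum_int_nonneg[of f, OF assms] by simp

text \<open>Extending the reciprocal by 0 to negative indices makes the recurrence below, and hence
  every shift of summation index, valid on all integers.\<close>

definition rqfac :: "complex \<Rightarrow> int \<Rightarrow> complex" where
  "rqfac q k = (if k < 0 then 0 else 1 / qpoch q q (nat k))"

lemma rqfac_neg [simp]: "k < 0 \<Longrightarrow> rqfac q k = 0"
  by (simp add: rqfac_def)

lemma rqfac_int [simp]: "rqfac q (int n) = 1 / qpoch q q n"
  by (simp add: rqfac_def)

lemma rqfac_rec:
  assumes "norm q < 1"
  shows "(1 - q powi k) * rqfac q k = rqfac q (k - 1)"
proof (cases "k > 0")
  case True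
  then obtain n where k: "k = int (Suc n)"
    by (metis Suc_pred' zero_less_imp_eq_int of_nat_0_less_iff)
  have "k - 1 = int n" using k by simp
  thus ?thesis unfolding \<open>k - 1 = int n\<close>
    using one_minus_power_neq_0[OF assms, of n] qpoch_self_neq_0[OF assms, of n]
    unfolding k rqfac_int power_int_of_nat qpoch_Suc by simp
next
  case False
  \<comment> \<open>At \<open>k = 0\<close> the factor \<open>1 - q^0\<close> vanishes, in agreement
    with \<open>rqfac q (-1) = 0\<close>.\<close>
  thus ?thesis by (cases "k = 0") auto
qed

text \<open>The \<open>q\<close>-Pascal rule, from
  \<open>1 - q^(a+b) = (1 - q^b) + q^b * (1 - q^a)\<close>.\<close>

lemma rqfac_pascal:
  assumes "norm q < 1" "q \<noteq> 0"
  shows "(1 - q powi (a + b)) * (rqfac q a * rqfac q b)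
           = rqfac q a * rqfac q (b - 1) + q powi b * (rqfac q (a - 1) * rqfac q b)"
  unfolding rqfac_rec[OF assms(1), symmetric] using assms(2)
  by (simp add: power_int_add algebra_simps)

lemma rqfac_bounded:
  assumes "norm q < 1"
  obtains C where "C > 0" "\<And>k. norm (rqfac q k) \<le> C"
proof -
  obtain C where C: "C > 0" "\<And>n. norm (1 / qpoch q q n) \<le> C"
    using inverse_qpoch_bounded[OF assms] by blast
  have "norm (rqfac q k) \<le> C" for k
    using C by (auto simp: rqfac_def)
  with C(1) show ?thesis using that by blast
qed

text \<open>For negative \<open>s\<close>, shifting \<open>m\<close> by \<open>-s\<close> exchanges
  the two reciprocal factors and replaces \<open>s\<close> by \<open>-s\<close>.\<close>

lemma cauchy_has_sum:
  assumes "norm q < 1"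
  shows "((\<lambda>m. q powi (m * (m + s)) * (rqfac q m * rqfac q (m + s))) has_sum (1 / qpoch_inf q q)) UNIV"
proof -
  have nonneg: "((\<lambda>m. q powi (m * (m + int n)) * (rqfac q m * rqfac q (m + int n)))
                  has_sum (1 / qpoch_inf q q)) UNIV" for n
  proof (subst has_sum_int_nonneg)
    have "((\<lambda>m. q ^ (m * (m + n)) / (qpoch q q m * qpoch q q (m + n))) has_sum (1 / qpoch_inf q q)) UNIV"
      using cauchy_sums[OF assms] by (simp add: has_sum_sums_iff)
    also have "(\<lambda>m. q ^ (m * (m + n)) / (qpoch q q m * qpoch q q (m + n))) =
       (\<lambda>m. q powi (int m * (int m + int n)) * (rqfac q (int m) * rqfac q (int m + int n)))"
      unfolding of_nat_add[symmetric] of_nat_mult[symmetric] rqfac_int power_int_of_nat by simp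
    finally show "((\<lambda>m. q powi (int m * (int m + int n)) * (rqfac q (int m) * rqfac q (int m + int n)))
                     has_sum (1 / qpoch_inf q q)) UNIV" .
  qed simp
  show ?thesis
  proof (cases "s \<ge> 0")
    case True
    thus ?thesis using nonneg[of "nat s"] by simp
  next
    case False
    thus ?thesis using nonneg[of "nat (-s)"]
      by (subst has_sum_int_shift[of _ "-s", symmetric]) (simp add: mult_ac)
  qed
qed

section \<open>Jacobi's triple product\<close>

text \<open>The polynomial extension of \<open>n choose 2\<close> to all integers.\<close>

definition tri :: "int \<Rightarrow> int" where "tri k = k * (k - 1) div 2"

lemma two_tri: "2 * tri k = k * (k - 1)"
  unfolding tri_def by (rule dvd_mult_div_cancel) simp

lemma tri_int: "tri (int n) = int (n choose 2)"
proof -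
  have "2 * int (n choose 2) = int n * (int n - 1)"
    by (induction n) (auto simp: numeral_2_eq_2 algebra_simps)
  thus ?thesis using two_tri[of "int n"] by simp
qed

lemma jacobi_triple_product:
  fixes x q :: complex
  assumes q: "norm q < 1" "q \<noteq> 0" and x: "x \<noteq> 0"
  shows "((\<lambda>s. x powi s * q powi tri s) has_sum
            (qpoch_inf (-x) q * qpoch_inf (-(q/x)) q * qpoch_inf q q)) UNIV"
proof -
  define E where "E x k = rqfac q k * q powi tri k * x powi k" for x k
  have E_int: "E x (int n) = euler_coeff q n * x ^ n" for x n
    by (simp add: E_def tri_int euler_coeff_def power_int_of_nat)
  have E_neg: "E x k = 0" if "k < 0" for x k
    using that by (simp add: E_def)
  have E_norm: "(\<lambda>k. norm (E x k)) summable_on UNIV" for x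
    using summable_norm_euler[OF q(1), of x]
    by (subst summable_on_int_nonneg) (simp_all add: E_neg E_int summable_on_nat_norm_iff del: norm_mult)
  have E_sum: "(E x has_sum qpoch_inf (-x) q) UNIV" for x
    using summable_norm_euler[OF q(1), of x] euler_sums[OF q(1), of x]
    by (subst has_sum_int_nonneg) (simp_all add: E_neg E_int has_sum_sums_iff del: norm_mult)
  define y where "y = q / x"
  have "((\<lambda>p. E x (fst p) * E y (snd p)) has_sum (qpoch_inf (-x) q * qpoch_inf (-y) q)) (UNIV \<times> UNIV)"
    by (intro has_sum_mult_Times E_norm E_sum)
  \<comment> \<open>Index pairs \<open>(m + s, m)\<close> are regrouped by their difference
    \<open>s\<close>; for fixed \<open>s\<close>, Cauchy's identity performs the sum over
    \<open>m\<close>.\<close>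
  moreover have "bij_betw (\<lambda>p. (snd p + fst p, snd p)) (UNIV \<times> UNIV :: (int \<times> int) set) (UNIV \<times> UNIV)"
    by (rule bij_betwI[of _ _ _ "\<lambda>p. (fst p - snd p, snd p)"]) auto
  ultimately have *: "((\<lambda>p. E x (snd p + fst p) * E y (snd p)) has_sum
      (qpoch_inf (-x) q * qpoch_inf (-y) q)) (UNIV \<times> UNIV)"
    by (subst (asm) has_sum_reindex_bij_betw[symmetric]) auto
  have "((\<lambda>s. x powi s * q powi tri s * (1 / qpoch_inf q q)) has_sum
          (qpoch_inf (-x) q * qpoch_inf (-y) q)) UNIV"
  proof (rule has_sum_SigmaD[OF *])
    fix s :: int
    have "E x (m + s) * E y m
            = x powi s * q powi tri s * (q powi (m * (m + s)) * (rqfac q m * rqfac q (m + s)))" for m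
    proof -
      \<comment> \<open>The lone summand \<open>m\<close> comes from the numerator of
        \<open>y = q / x\<close>; it completes the exponent to the one in Cauchy's identity.\<close>
      have "tri (m + s) + tri m + m = tri s + m * (m + s)"
        using two_tri[of "m + s"] two_tri[of m] two_tri[of s] by (simp add: algebra_simps)
      hence *: "q powi tri (m + s) * q powi tri m * q powi m = q powi tri s * q powi (m * (m + s))"
        using q(2) by (simp add: power_int_add[symmetric])
      have "x powi (m + s) * y powi m = x powi s * q powi m"
        using x by (simp add: y_def power_int_add power_int_divide_distrib)
      moreover have "E x (m + s) * E y m = rqfac q m * rqfac q (m + s) *
                       (q powi tri (m + s) * q powi tri m) * (x powi (m + s) * y powi m)"
        unfolding E_def by (simp only: mult_ac)
      ultimately have "E x (m + s) * E y m = rqfac q m * rqfac q (m + s) * x powi s *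
                         (q powi tri (m + s) * q powi tri m * q powi m)"
        by (simp only: mult_ac)
      also note *
      finally show ?thesis by (simp only: mult_ac)
    qed
    thus "((\<lambda>m. E x (snd (s, m) + fst (s, m)) * E y (snd (s, m)))
            has_sum x powi s * q powi tri s * (1 / qpoch_inf q q)) UNIV"
      using has_sum_cmult_right[OF cauchy_has_sum[OF q(1), of s], of "x powi s * q powi tri s"] by simp
  qed
  from has_sum_cmult_left[OF this, of "qpoch_inf q q"] show ?thesis
    using qpoch_inf_self_neq_0[OF q(1)] by (simp add: y_def)
qed

section \<open>Finite forms of the Rogers--Selberg identities\<close>

text \<open>The generalized pentagonal numbers.\<close>

definition pent :: "int \<Rightarrow> int" where "pent r = r * (3 * r + 1) div 2"

lemma two_pent: "2 * pent r = r * (3 * r + 1)"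
  unfolding pent_def by (rule dvd_mult_div_cancel) simp

text \<open>The linear parameter \<open>e\<close> makes the family closed, up to a factor, under
  reflection and shift of \<open>r\<close>.\<close>

definition pent_wt :: "complex \<Rightarrow> int \<Rightarrow> int \<Rightarrow> complex" where
  "pent_wt q e r = (-1) powi r * q powi (pent r + e * r)"

lemma minus_one_powi_minus: "(-1 :: complex) powi (-r) = (-1) powi r"
  by (cases "even r") (simp_all add: power_int_minus_left)

lemma pent_wt_uminus: "pent_wt q e (- r) = pent_wt q (-1 - e) r"
proof -
  have "pent (-r) = pent r - r"
    using two_pent[of r] two_pent[of "-r"] by (simp add: algebra_simps)
  hence "pent (-r) + e * (-r) = pent r + (-1 - e) * r" by (simp add: algebra_simps)
  thus ?thesis unfolding pent_wt_def minus_one_powi_minus by simp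
qed

lemma pent_wt_shift:
  assumes "q \<noteq> 0"
  shows "pent_wt q e (r + 1) = - (q powi (2 + e)) * pent_wt q (e + 3) r"
proof -
  have "pent (r + 1) = pent r + 3 * r + 2"
    using two_pent[of r] two_pent[of "r + 1"] by (simp add: algebra_simps)
  hence "pent (r + 1) + e * (r + 1) = (2 + e) + (pent r + (e + 3) * r)"
    by (simp add: algebra_simps)
  hence "q powi (pent (r + 1) + e * (r + 1)) = q powi (2 + e) * q powi (pent r + (e + 3) * r)"
    using assms by (metis power_int_add)
  thus ?thesis by (simp add: pent_wt_def power_int_add)
qed

text \<open>Only finitely many \<open>r\<close> contribute, but summing over all integers lets
  reflections and shifts act without boundary terms.\<close>

definition selbergA :: "complex \<Rightarrow> int \<Rightarrow> int \<Rightarrow> complex" where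
  "selbergA q e n = (\<Sum>\<^sub>\<infinity>r. pent_wt q e r * (rqfac (q^2) (n - r) * rqfac (q^2) (n + r)))"

definition selbergB :: "complex \<Rightarrow> int \<Rightarrow> int \<Rightarrow> complex" where
  "selbergB q e n = (\<Sum>\<^sub>\<infinity>r. pent_wt q e r * (rqfac (q^2) (n - r) * rqfac (q^2) (n + r + 1)))"

text \<open>The two reciprocal factors vanish unless \<open>-m \<le> r \<le> n\<close>, so the sum
  is finite.\<close>

lemma rqfac_mult_has_sum:
  fixes f :: "int \<Rightarrow> complex"
  assumes "\<And>r. f r = w r * (rqfac q (n - r) * rqfac q (m + r))"
  shows "(f has_sum infsum f UNIV) UNIV"
proof (rule has_sum_infsum)
  have "f summable_on {-m..n}" by simp
  thus "f summable_on UNIV"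
    by (rule summable_on_cong_neutral[THEN iffD1, rotated -1]) (auto simp: assms)
qed

lemma selbergA_has_sum:
  "((\<lambda>r. pent_wt q e r * (rqfac (q^2) (n - r) * rqfac (q^2) (n + r))) has_sum selbergA q e n) UNIV"
  unfolding selbergA_def by (rule rqfac_mult_has_sum) (rule refl)

lemma selbergB_has_sum:
  "((\<lambda>r. pent_wt q e r * (rqfac (q^2) (n - r) * rqfac (q^2) (n + r + 1))) has_sum selbergB q e n) UNIV"
  unfolding selbergB_def
  by (rule rqfac_mult_has_sum[where n = n and m = "n + 1"]) (simp add: add_ac)

lemma selbergA_reflect: "selbergA q (-1 - e) n = selbergA q e n"
proof (rule has_sum_unique)
  show "((\<lambda>r. pent_wt q e (0 - r) * (rqfac (q^2) (n - (0 - r)) * rqfac (q^2) (n + (0 - r)))) has_sum selbergA q e n) UNIV"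
    using selbergA_has_sum[of q e n] by (subst has_sum_int_reflect)
  show "((\<lambda>r. pent_wt q e (0 - r) * (rqfac (q^2) (n - (0 - r)) * rqfac (q^2) (n + (0 - r)))) has_sum selbergA q (-1 - e) n) UNIV"
    using selbergA_has_sum[of q "-1 - e" n] by (simp add: pent_wt_uminus mult_ac)
qed

text \<open>The reflection of \<open>r\<close> to \<open>-1 - r\<close> exchanges the two reciprocal
  factors and, exactly when \<open>e = 1\<close>, only changes the sign of the weight. The sum
  therefore equals its own negative.\<close>

lemma selbergB_1:
  assumes "q \<noteq> 0"
  shows "selbergB q 1 n = 0"
proof -
  have "selbergB q 1 n = - selbergB q 1 n"
  proof (rule has_sum_unique)
    define F where "F r = pent_wt q 1 r * (rqfac (q^2) (n - r) * rqfac (q^2) (n + r + 1))" for r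
    have "F (-1 - r) = - F r" for r
    proof -
      have "pent_wt q 1 (-1 - r) = pent_wt q (-2) (r + 1)"
        using pent_wt_uminus[of q 1 "r + 1"] by (simp add: algebra_simps)
      also have "\<dots> = - pent_wt q 1 r"
        using pent_wt_shift[OF assms, of "-2" r] by simp
      finally show ?thesis by (simp add: F_def algebra_simps)
    qed
    moreover have "(F has_sum selbergB q 1 n) UNIV"
      using selbergB_has_sum[of q 1 n] by (simp add: F_def[abs_def])
    ultimately show "((\<lambda>r. - F r) has_sum selbergB q 1 n) UNIV"
      using has_sum_int_reflect[of F "-1"] by simp
    show "((\<lambda>r. - F r) has_sum - selbergB q 1 n) UNIV"
      by (simp add: has_sum_uminus) fact
  qed
  thus ?thesis by simp
qed

lemma power2_powi: "(q^2) powi k = (q :: complex) powi (2 * k)"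
  using power_int_mult[of q 2 k] by simp

text \<open>The algebra common to both recurrences: the first assumption is the Pascal rule, the
  second trades the power of \<open>q\<close> on its last term for a shifted weight.\<close>

lemma weighted_combine:
  fixes a c p w w' x y z :: complex
  assumes "p * a = x + z * y" "z * w = - c * w'"
  shows "p * (w * a) = w * x + - (c * (w' * y))"
proof -
  have "p * (w * a) = w * (p * a)" by (simp only: mult_ac)
  also have "\<dots> = w * x + (z * w) * y" unfolding assms(1) by (simp only: distrib_left mult_ac)
  also have "\<dots> = w * x + - (c * (w' * y))" unfolding assms(2) by simp
  finally show ?thesis .
qed

text \<open>The Pascal rule in base \<open>q^2\<close> is applied with \<open>a = n - r\<close> and
  \<open>b = n + r + 1\<close>. Its first term belongs to \<open>selbergA q e n\<close>; its second
  is a summand of \<open>selbergA q (e - 1) n\<close> taken at \<open>r + 1\<close>, which shift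
  invariance absorbs.\<close>

lemma selbergB_rec:
  assumes q: "norm q < 1" "q \<noteq> 0"
  shows "(1 - q powi (4 * n + 2)) * selbergB q e n
           = selbergA q e n - q powi (2 * n + 1 - e) * selbergA q (e - 1) n"
proof (rule has_sum_unique)
  define g where "g = rqfac (q^2)"
  have q2: "norm (q^2) < 1" "q^2 \<noteq> 0"
    using q by (auto simp: norm_power power_less_one_iff)
  define F where "F r = - (q powi (2 * n + 1 - e) * (pent_wt q (e - 1) r * (g (n - r) * g (n + r))))" for r
  have "((\<lambda>r. (1 - q powi (4 * n + 2)) * (pent_wt q e r * (g (n - r) * g (n + r + 1)))) has_sum
          (1 - q powi (4 * n + 2)) * selbergB q e n) UNIV"
    unfolding g_def by (intro has_sum_cmult_right selbergB_has_sum)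
  moreover have "(1 - q powi (4 * n + 2)) * (pent_wt q e r * (g (n - r) * g (n + r + 1)))
      = pent_wt q e r * (g (n - r) * g (n + r)) + F (r + 1)" for r
  proof -
    have "(1 - q powi (4 * n + 2)) * (g (n - r) * g (n + r + 1))
        = g (n - r) * g (n + r) + q powi (2 * (n + r + 1)) * (g (n - (r + 1)) * g (n + (r + 1)))"
    proof -
      have e: "2 * (n - r + (n + r + 1)) = 4 * n + 2" "n + r + 1 - 1 = n + r"
        "n - r - 1 = n - (r + 1)" "n + r + 1 = n + (r + 1)" by simp_all
      show ?thesis
        using rqfac_pascal[OF q2, of "n - r" "n + r + 1", unfolded power2_powi e(1-3)]
        unfolding g_def e(4) .
    qed
    moreover have "q powi (2 * (n + r + 1)) * pent_wt q e r
                    = - (q powi (2 * n + 1 - e)) * pent_wt q (e - 1) (r + 1)"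
    proof -
      have "q powi (2 * n + 1 - e) * q powi (2 + (e - 1)) * q powi (pent r + (e + 2) * r)
              = q powi (2 * (n + r + 1)) * q powi (pent r + e * r)"
        using q(2) by (simp add: power_int_add[symmetric] algebra_simps)
      thus ?thesis unfolding pent_wt_shift[OF q(2)]
        by (simp add: pent_wt_def algebra_simps)
    qed
    ultimately show ?thesis unfolding F_def by (rule weighted_combine)
  qed
  ultimately show "((\<lambda>r. pent_wt q e r * (g (n - r) * g (n + r)) + F (r + 1)) has_sum
          (1 - q powi (4 * n + 2)) * selbergB q e n) UNIV" by simp
  have "(F has_sum - (q powi (2 * n + 1 - e) * selbergA q (e - 1) n)) UNIV"
    unfolding F_def g_def has_sum_uminus minus_minus by (intro has_sum_cmult_right selbergA_has_sum)
  hence "((\<lambda>r. F (r + 1)) has_sum - (q powi (2 * n + 1 - e) * selbergA q (e - 1) n)) UNIV"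
    by (subst has_sum_int_shift)
  from has_sum_add[OF selbergA_has_sum this, of q e n]
  show "((\<lambda>r. pent_wt q e r * (g (n - r) * g (n + r)) + F (r + 1)) has_sum
          selbergA q e n - q powi (2 * n + 1 - e) * selbergA q (e - 1) n) UNIV"
    by (simp add: g_def)
qed

text \<open>Here the Pascal rule is used with \<open>a = n + 1 + r\<close> and
  \<open>b = n + 1 - r\<close>, so the second term is shifted to \<open>r - 1\<close> and
  \<open>e\<close> goes up instead of down.\<close>

lemma selbergA_rec:
  assumes q: "norm q < 1" "q \<noteq> 0"
  shows "(1 - q powi (4 * n + 4)) * selbergA q e (n + 1)
           = selbergB q e n - q powi (2 * n + 2 + e) * selbergB q (e + 1) n"
proof (rule has_sum_unique)
  define g where "g = rqfac (q^2)"
  have q2: "norm (q^2) < 1" "q^2 \<noteq> 0"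
    using q by (auto simp: norm_power power_less_one_iff)
  define F where "F r = - (q powi (2 * n + 2 + e) * (pent_wt q (e + 1) r * (g (n - r) * g (n + r + 1))))" for r
  have "((\<lambda>r. (1 - q powi (4 * n + 4)) * (pent_wt q e r * (g (n + 1 - r) * g (n + 1 + r)))) has_sum
          (1 - q powi (4 * n + 4)) * selbergA q e (n + 1)) UNIV"
    unfolding g_def by (intro has_sum_cmult_right selbergA_has_sum)
  moreover have "(1 - q powi (4 * n + 4)) * (pent_wt q e r * (g (n + 1 - r) * g (n + 1 + r)))
      = pent_wt q e r * (g (n - r) * g (n + r + 1)) + F (r + (-1))" for r
  proof -
    have "(1 - q powi (4 * n + 4)) * (g (n + 1 - r) * g (n + 1 + r))
        = g (n - r) * g (n + r + 1) + q powi (2 * (n + 1 - r)) * (g (n - (r - 1)) * g (n + (r - 1) + 1))"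
    proof -
      have e: "2 * (n + 1 + r + (n + 1 - r)) = 4 * n + 4" "n + 1 - r - 1 = n - r"
        "n + 1 + r - 1 = n + (r - 1) + 1" "n + r + 1 = n + 1 + r" "n + 1 - r = n - (r - 1)" by simp_all
      show ?thesis
        using rqfac_pascal[OF q2, of "n + 1 + r" "n + 1 - r", unfolded power2_powi e(1-3)]
        unfolding g_def e(4) unfolding e(5) by (simp only: mult_ac)
    qed
    moreover have "q powi (2 * (n + 1 - r)) * pent_wt q e r
                    = - (q powi (2 * n + 2 + e)) * pent_wt q (e + 1) (r - 1)"
    proof -
      have "q powi (2 * (n + 1 - r)) * q powi (2 + e) * q powi (pent (r - 1) + (e + 3) * (r - 1))
              = q powi (2 * n + 2 + e) * q powi (pent (r - 1) + (e + 1) * (r - 1))"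
        using q(2) by (simp add: power_int_add[symmetric] algebra_simps)
      thus ?thesis using pent_wt_shift[OF q(2), of e "r - 1"]
        by (simp add: pent_wt_def algebra_simps)
    qed
    ultimately show ?thesis unfolding F_def diff_conv_add_uminus by (rule weighted_combine)
  qed
  ultimately show "((\<lambda>r. pent_wt q e r * (g (n - r) * g (n + r + 1)) + F (r + (-1))) has_sum
          (1 - q powi (4 * n + 4)) * selbergA q e (n + 1)) UNIV" by simp
  have "(F has_sum - (q powi (2 * n + 2 + e) * selbergB q (e + 1) n)) UNIV"
    unfolding F_def g_def has_sum_uminus minus_minus by (intro has_sum_cmult_right selbergB_has_sum)
  hence "((\<lambda>r. F (r + (-1))) has_sum - (q powi (2 * n + 2 + e) * selbergB q (e + 1) n)) UNIV"
    by (subst has_sum_int_shift)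
  from has_sum_add[OF selbergB_has_sum this, of q e n]
  show "((\<lambda>r. pent_wt q e r * (g (n - r) * g (n + r + 1)) + F (r + (-1))) has_sum
          selbergB q e n - q powi (2 * n + 2 + e) * selbergB q (e + 1) n) UNIV"
    by (simp add: g_def)
qed

lemma powi_nat_eq: "k = int n \<Longrightarrow> q powi k = q ^ n"
  by simp

text \<open>At \<open>e = 0\<close> reflection identifies \<open>selbergA q (-1)\<close> with
  \<open>selbergA q 0\<close>. The common factor \<open>1 - q^(2n+1)\<close> then cancels from
  \<open>1 - q^(4n+2)\<close>.\<close>

lemma selbergB_0_selbergA_0:
  assumes q: "norm q < 1" "q \<noteq> 0"
  shows "(1 + q ^ (2 * n + 1)) * selbergB q 0 (int n) = selbergA q 0 (int n)"
proof -
  have e: "q powi (4 * int n + 2) = q ^ (2 * n + 1) * q ^ (2 * n + 1)"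
    by (subst powi_nat_eq[of _ "4 * n + 2"]) (auto simp flip: power_add)
  have e': "q powi (2 * int n + 1 - 0) = q ^ (2 * n + 1)"
    by (rule powi_nat_eq) auto
  have "(1 - q ^ (2 * n + 1)) * ((1 + q ^ (2 * n + 1)) * selbergB q 0 (int n))
          = (1 - q ^ (2 * n + 1)) * selbergA q 0 (int n)"
    using selbergB_rec[OF q, of "int n" 0] selbergA_reflect[of q 0 "int n"] unfolding e e'
    by (simp add: algebra_simps)
  thus ?thesis using one_minus_power_neq_0[OF q(1), of "2 * n"]
    by (simp only: mult_cancel_left) simp
qed

text \<open>At \<open>e = 1\<close> the vanishing of \<open>selbergB q 1\<close> expresses
  \<open>selbergA q 1\<close> through \<open>selbergA q 0\<close>. At \<open>e = -1\<close>
  reflection leaves only these two, and the factor \<open>1 - q^(4n+2)\<close> appears on both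
  sides.\<close>

lemma selbergB_minus_1_selbergA_0:
  assumes q: "norm q < 1" "q \<noteq> 0"
  shows "selbergB q (-1) (int n) = selbergA q 0 (int n)"
proof -
  have e: "q powi (4 * int n + 2) = q ^ (4 * n + 2)"
    by (rule powi_nat_eq) auto
  have e1: "q powi (2 * int n + 1 - 1) = q ^ (2 * n)"
    by (rule powi_nat_eq) auto
  have e2: "q powi (2 * int n + 1 - (-1)) = q ^ (2 * n + 2)"
    by (rule powi_nat_eq) auto
  have A1: "selbergA q 1 (int n) = q ^ (2 * n) * selbergA q 0 (int n)"
    using selbergB_rec[OF q, of "int n" 1] selbergB_1[OF q(2)] unfolding e1 by simp
  have "(1 - q ^ (4 * n + 2)) * selbergB q (-1) (int n)
          = selbergA q 0 (int n) - q ^ (2 * n + 2) * selbergA q 1 (int n)"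
    using selbergB_rec[OF q, of "int n" "-1"] selbergA_reflect[of q 0 "int n"] selbergA_reflect[of q 1 "int n"]
    unfolding e e2 by simp
  also have "\<dots> = (1 - q ^ (4 * n + 2)) * selbergA q 0 (int n)"
    unfolding A1 by (simp add: algebra_simps flip: power_add)
  finally show ?thesis using one_minus_power_neq_0[OF q(1), of "4 * n + 1"]
    by (simp only: mult_cancel_left) simp
qed

text \<open>Induction on \<open>n\<close>: \<open>selbergA_rec\<close> at \<open>e = 0\<close> loses
  its second term because \<open>selbergB q 1\<close> vanishes, and \<open>selbergB q 0\<close> is
  known from \<open>selbergA q 0\<close>.\<close>

lemma selbergA_0:
  assumes q: "norm q < 1" "q \<noteq> 0"
  shows "selbergA q 0 (int n) = 1 / (qpoch (q^2) (q^2) n * qpoch (-q) q (2 * n))"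
proof (induction n)
  case 0
  have "((\<lambda>r. pent_wt q 0 r * (rqfac (q^2) (0 - r) * rqfac (q^2) (0 + r))) has_sum 1) {0}"
    using has_sum_finite[of "{0}" "\<lambda>r. pent_wt q 0 r * (rqfac (q^2) (0 - r) * rqfac (q^2) (0 + r))"]
    by (simp add: pent_wt_def pent_def rqfac_def)
  hence "((\<lambda>r. pent_wt q 0 r * (rqfac (q^2) (0 - r) * rqfac (q^2) (0 + r))) has_sum 1) UNIV"
    by (rule has_sum_cong_neutral[THEN iffD1, rotated -1]) (auto simp: rqfac_def)
  thus ?case using has_sum_unique[OF selbergA_has_sum[of q 0 0]] by simp
next
  case (Suc n)
  \<comment> \<open>Written as a square so that \<open>1 - q^(4n+4)\<close> splits into the new
    factor of \<open>(q^2;q^2)\<close> and the last new factor of \<open>(-q;q)\<close>.\<close>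
  have e: "q powi (4 * int n + 4) = (q ^ (2 * n + 2))^2"
    unfolding power_mult[symmetric] by (rule powi_nat_eq) simp
  have factor: "1 - y^2 = (1 - y) * (1 + y)" for y :: complex
    by (simp add: algebra_simps power2_eq_square)
  have nz: "1 - q ^ (2 * n + 2) \<noteq> 0" "1 + q ^ (2 * n + 2) \<noteq> 0" "1 + q ^ (2 * n + 1) \<noteq> 0"
    using one_minus_power_neq_0[OF q(1), of "2 * n + 1"] one_plus_power_neq_0[OF q(1), of "2 * n + 1"]
      one_plus_power_neq_0[OF q(1), of "2 * n"] by auto
  have "(1 - (q ^ (2 * n + 2))^2) * selbergA q 0 (int (Suc n)) = selbergB q 0 (int n)"
    using selbergA_rec[OF q, of "int n" 0] selbergB_1[OF q(2)] unfolding e by (simp add: add.commute)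
  hence "selbergA q 0 (int (Suc n)) = selbergB q 0 (int n) / ((1 - q ^ (2 * n + 2)) * (1 + q ^ (2 * n + 2)))"
    using nz(1,2) by (metis factor nonzero_eq_divide_eq mult.commute no_zero_divisors)
  also have "selbergB q 0 (int n) = selbergA q 0 (int n) / (1 + q ^ (2 * n + 1))"
    using selbergB_0_selbergA_0[OF q, of n] nz by (simp add: nonzero_eq_divide_eq mult.commute)
  finally have 1: "selbergA q 0 (int (Suc n)) = selbergA q 0 (int n) /
      (1 + q ^ (2 * n + 1)) / ((1 - q ^ (2 * n + 2)) * (1 + q ^ (2 * n + 2)))" .
  have "(q^2) * (q^2) ^ n = q ^ (2 * n + 2)"
    unfolding power_add power_mult by (rule mult.commute)
  hence 2: "qpoch (q^2) (q^2) (Suc n) = qpoch (q^2) (q^2) n * (1 - q ^ (2 * n + 2))"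
    by (simp only: qpoch_Suc)
  have "2 * Suc n = Suc (Suc (2 * n))" by simp
  hence 3: "qpoch (-q) q (2 * Suc n) = qpoch (-q) q (2 * n) * (1 + q ^ (2 * n + 1)) * (1 + q ^ (2 * n + 2))"
    by (simp only: qpoch_Suc) simp
  show ?case unfolding 1 2 3 Suc.IH by (simp only: divide_divide_eq_left mult_ac)
qed

lemma selbergB_0:
  assumes q: "norm q < 1" "q \<noteq> 0"
  shows "selbergB q 0 (int n) = 1 / (qpoch (q^2) (q^2) n * qpoch (-q) q (2 * n + 1))"
proof -
  have "1 + q ^ (2 * n + 1) \<noteq> 0"
    using one_plus_power_neq_0[OF q(1), of "2 * n"] by simp
  hence "selbergB q 0 (int n) = selbergA q 0 (int n) / (1 + q ^ (2 * n + 1))"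
    using selbergB_0_selbergA_0[OF q, of n] by (simp add: nonzero_eq_divide_eq mult.commute)
  thus ?thesis by (simp add: selbergA_0[OF q] qpoch_Suc mult_ac)
qed

section \<open>Theta series and the interchange of summations\<close>

lemma theta_has_sum:
  assumes q: "norm q < 1" "q \<noteq> 0" and a: "a \<le> k" "k > 0"
  shows "((\<lambda>r. (-1) powi r * q powi (int k * tri r + int a * r)) has_sum
            (qpoch_inf (q ^ a) (q ^ k) * qpoch_inf (q ^ (k - a)) (q ^ k) * qpoch_inf (q ^ k) (q ^ k))) UNIV"
proof -
  have "norm (q ^ k) < 1"
    using q a by (simp add: norm_power power_less_one_iff)
  moreover have "q ^ k / q ^ a = q ^ (k - a)"
    using q a by (simp add: power_diff)
  moreover have "(- (q ^ a)) powi r * (q ^ k) powi tri r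
                   = (-1) powi r * q powi (int k * tri r + int a * r)" for r
  proof -
    have "(- (q ^ a)) powi r = (-1) powi r * q powi (int a * r)"
      using power_int_mult_distrib[of "-1" "q ^ a" r] by (simp add: power_int_mult)
    moreover have "(q ^ k) powi tri r = q powi (int k * tri r)"
      by (simp add: power_int_mult)
    ultimately show ?thesis using q(2) by (simp add: power_int_add)
  qed
  \<comment> \<open>The triple product is taken in base \<open>q ^ k\<close> at
    \<open>x = - (q ^ a)\<close>.\<close>
  ultimately show ?thesis
    using jacobi_triple_product[of "q ^ k" "- (q ^ a)"] q(2) by simp
qed

text \<open>Absolute convergence is read off from the triple product, since summability of complex
  families is absolute.\<close>

lemma theta_norm_summable:
  fixes q :: complex
  assumes "norm q < 1" "q \<noteq> 0" "a \<le> k" "k > 0"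
  shows "(\<lambda>r. norm (q powi (int k * tri r + int a * r))) summable_on UNIV"
proof -
  have "(\<lambda>r. (-1) powi r * q powi (int k * tri r + int a * r)) summable_on UNIV"
    using theta_has_sum[OF assms] by (auto simp: summable_on_def)
  hence "(\<lambda>r. norm ((-1) powi r * q powi (int k * tri r + int a * r))) summable_on UNIV"
    by (subst (asm) summable_on_iff_abs_summable_on_complex)
  thus ?thesis by (simp add: norm_mult norm_power_int)
qed

text \<open>A limiting case of Bailey's lemma. With \<open>n = m + r\<close> the exponent becomes
  \<open>r(r+d) + m(m+2r+d)\<close>, and Cauchy's identity with \<open>s = 2r + d\<close> sums over
  \<open>m\<close> to a value free of \<open>r\<close>. Boundedness of \<open>rqfac\<close> gives
  the absolute convergence behind the interchange.\<close>

lemma bailey_transform: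
  assumes q: "norm q < 1" "q \<noteq> 0"
    and w: "(\<lambda>r. norm (w r)) summable_on UNIV"
    and v: "(\<lambda>n. norm (q powi (n * (n + d)))) summable_on UNIV"
    and S: "\<And>n. ((\<lambda>r. w r * (rqfac q (n - r) * rqfac q (n + r + d))) has_sum S n) UNIV"
    and T: "((\<lambda>r. w r * q powi (r * (r + d))) has_sum T) UNIV"
  shows "((\<lambda>n. q powi (n * (n + d)) * S n) has_sum (T / qpoch_inf q q)) UNIV"
proof -
  define F where "F = (\<lambda>p. w (fst p) * q powi (snd p * (snd p + d)) *
                          (rqfac q (snd p - fst p) * rqfac q (snd p + fst p + d)))"
  obtain C where C: "C > 0" "\<And>k. norm (rqfac q k) \<le> C"
    using rqfac_bounded[OF q(1)] by blast
  have "(\<lambda>p. C * C * norm (w (fst p) * q powi (snd p * (snd p + d)))) summable_on UNIV \<times> UNIV"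
    using w v by (intro summable_on_cmult_right summable_on_norm_mult_Times)
  hence "(\<lambda>p. norm (F p)) summable_on UNIV \<times> UNIV"
  proof (rule summable_on_comparison_test)
    fix p
    have "norm (F p) = norm (w (fst p) * q powi (snd p * (snd p + d))) *
            (norm (rqfac q (snd p - fst p)) * norm (rqfac q (snd p + fst p + d)))"
      unfolding F_def by (simp only: norm_mult)
    also have "\<dots> \<le> norm (w (fst p) * q powi (snd p * (snd p + d))) * (C * C)"
      using C by (intro mult_left_mono mult_mono) auto
    finally show "norm (F p) \<le> C * C * norm (w (fst p) * q powi (snd p * (snd p + d)))"
      by (simp only: mult_ac)
  qed auto
  hence summable: "F summable_on UNIV \<times> UNIV"
    by (rule abs_summable_summable)
  have "(F has_sum (T * (1 / qpoch_inf q q))) (UNIV \<times> UNIV)"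
  proof (rule has_sum_SigmaI[OF _ _ summable])
    show "((\<lambda>r. w r * q powi (r * (r + d)) * (1 / qpoch_inf q q)) has_sum T * (1 / qpoch_inf q q)) UNIV"
      by (rule has_sum_cmult_left[OF T])
    fix r
    have "F (r, m + r) = w r * q powi (r * (r + d)) *
             (q powi (m * (m + (2 * r + d))) * (rqfac q m * rqfac q (m + (2 * r + d))))" for m
    proof -
      have "(m + r) * (m + r + d) = r * (r + d) + m * (m + (2 * r + d))"
        "m + r + r + d = m + (2 * r + d)" "m + r - r = m"
        by (simp_all add: algebra_simps)
      thus ?thesis using q(2) unfolding F_def fst_conv snd_conv by (simp only: power_int_add mult_ac simp_thms)
    qed
    hence "((\<lambda>m. F (r, m + r)) has_sum w r * q powi (r * (r + d)) * (1 / qpoch_inf q q)) UNIV"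
      using has_sum_cmult_right[OF cauchy_has_sum[OF q(1), of "2 * r + d"], of "w r * q powi (r * (r + d))"]
      by simp
    thus "((\<lambda>n. F (r, n)) has_sum w r * q powi (r * (r + d)) * (1 / qpoch_inf q q)) UNIV"
      using has_sum_int_shift[of "\<lambda>n. F (r, n)" r] by simp
  qed
  hence swapped: "((\<lambda>(n, r). F (r, n)) has_sum (T * (1 / qpoch_inf q q))) (UNIV \<times> UNIV)"
    by (subst (asm) has_sum_swap)
  have "((\<lambda>n. q powi (n * (n + d)) * S n) has_sum (T * (1 / qpoch_inf q q))) UNIV"
  proof (rule has_sum_SigmaD[OF swapped])
    fix n
    show "((\<lambda>r. case (n, r) of (n, r) \<Rightarrow> F (r, n)) has_sum q powi (n * (n + d)) * S n) UNIV"
      using has_sum_cmult_right[OF S[of n], of "q powi (n * (n + d))"] by (simp add: F_def mult_ac)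
  qed
  thus ?thesis by simp
qed

section \<open>The Rogers--Selberg identities\<close>

lemma pent_wt_altdef: "pent_wt q e r = (-1) powi r * q powi (3 * tri r + (2 + e) * r)"
proof -
  have "pent r + e * r = 3 * tri r + (2 + e) * r"
    using two_pent[of r] two_tri[of r] by (simp add: algebra_simps)
  thus ?thesis by (simp only: pent_wt_def)
qed

lemma pent_wt_norm_summable:
  assumes "norm q < 1" "q \<noteq> 0" "e = 0 \<or> e = -1"
  shows "(\<lambda>r. norm (pent_wt q e r)) summable_on UNIV"
  using theta_norm_summable[OF assms(1,2), of "nat (2 + e)" 3] assms(3)
  by (elim disjE) (simp_all add: pent_wt_altdef norm_mult norm_power_int)

lemma square_powi_norm_summable:
  fixes q :: complex
  assumes "norm q < 1" "q \<noteq> 0" "d = 0 \<or> d = 1"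
  shows "(\<lambda>n. norm ((q^2) powi (n * (n + d)))) summable_on UNIV"
proof -
  have "2 * (n * (n + d)) = int 4 * tri n + int (nat (2 + 2 * d)) * n" for n
    using two_tri[of n] assms(3) by (auto simp: algebra_simps)
  thus ?thesis
    using theta_norm_summable[OF assms(1,2), of "nat (2 + 2 * d)" 4] assms(3)
    unfolding power2_powi by auto
qed

text \<open>The modulus 7 arises as 3 + 4: the weight contributes \<open>3 * tri r\<close>, and
  \<open>2 * r^2 = 4 * tri r + 2 * r\<close>.\<close>

lemma pent_wt_theta_has_sum:
  assumes q: "norm q < 1" "q \<noteq> 0" and a: "int a = 4 + e + 2 * d" "a \<le> 7"
  shows "((\<lambda>r. pent_wt q e r * (q^2) powi (r * (r + d))) has_sum
           (qpoch_inf (q ^ a) (q ^ 7) * qpoch_inf (q ^ (7 - a)) (q ^ 7) * qpoch_inf (q ^ 7) (q ^ 7))) UNIV"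
proof -
  have "pent_wt q e r * (q^2) powi (r * (r + d)) = (-1) powi r * q powi (int 7 * tri r + int a * r)" for r
  proof -
    have "(3 * tri r + (2 + e) * r) + 2 * (r * (r + d)) = int 7 * tri r + int a * r"
      using two_tri[of r] unfolding a by (simp add: algebra_simps)
    thus ?thesis using q(2)
      unfolding pent_wt_altdef power2_powi by (metis mult.assoc power_int_add)
  qed
  thus ?thesis using theta_has_sum[OF q a(2)] by simp
qed

lemma selbergA_neg: "n < 0 \<Longrightarrow> selbergA q e n = 0"
  unfolding selbergA_def by (rule infsum_0) (auto simp: rqfac_def)

lemma selbergB_neg: "n < 0 \<Longrightarrow> selbergB q e n = 0"
  unfolding selbergB_def by (rule infsum_0) (auto simp: rqfac_def)

text \<open>The transform in base \<open>q^2\<close> is used with \<open>(e, d) = (0, 0)\<close> for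
  \<open>selbergA\<close>, then \<open>(-1, 1)\<close> and \<open>(0, 1)\<close> for
  \<open>selbergB\<close>; the theta parameter \<open>4 + e + 2d\<close> is 4, 5 and 6.\<close>

lemma rogers_selberg:
  assumes q: "norm q < 1" "q \<noteq> 0"
  shows "((\<lambda>n. q ^ (2 * n^2) / (qpoch (q^2) (q^2) n * qpoch (-q) q (2 * n))) has_sum
           (qpoch_inf (q^3) (q^7) * qpoch_inf (q^4) (q^7) * qpoch_inf (q^7) (q^7) / qpoch_inf (q^2) (q^2))) UNIV"
      (is ?th1)
    and "((\<lambda>n. q ^ (2 * n^2 + 2 * n) / (qpoch (q^2) (q^2) n * qpoch (-q) q (2 * n))) has_sum
           (qpoch_inf (q^2) (q^7) * qpoch_inf (q^5) (q^7) * qpoch_inf (q^7) (q^7) / qpoch_inf (q^2) (q^2))) UNIV"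
      (is ?th2)
    and "((\<lambda>n. q ^ (2 * n^2 + 2 * n) / (qpoch (q^2) (q^2) n * qpoch (-q) q (2 * n + 1))) has_sum
           (qpoch_inf q (q^7) * qpoch_inf (q^6) (q^7) * qpoch_inf (q^7) (q^7) / qpoch_inf (q^2) (q^2))) UNIV"
      (is ?th3)
proof -
  have q2: "norm (q^2) < 1" "q^2 \<noteq> 0"
    using q by (auto simp: norm_power power_less_one_iff)
  have e0: "(q^2) powi (int n * (int n + 0)) = q ^ (2 * n^2)" for n
    unfolding power2_powi by (rule powi_nat_eq) (simp add: power2_eq_square)
  have e1: "(q^2) powi (int n * (int n + 1)) = q ^ (2 * n^2 + 2 * n)" for n
    unfolding power2_powi by (rule powi_nat_eq) (simp add: power2_eq_square algebra_simps)
  have "((\<lambda>n. (q^2) powi (n * (n + 0)) * selbergA q 0 n) has_sum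
           (qpoch_inf (q^4) (q^7) * qpoch_inf (q^(7-4)) (q^7) * qpoch_inf (q^7) (q^7) / qpoch_inf (q^2) (q^2))) UNIV"
    using selbergA_has_sum[of q 0]
    by (intro bailey_transform[OF q2 pent_wt_norm_summable[OF q, of 0]] square_powi_norm_summable
              pent_wt_theta_has_sum q) auto
  hence "((\<lambda>n. q ^ (2 * n^2) * selbergA q 0 (int n)) has_sum
           (qpoch_inf (q^4) (q^7) * qpoch_inf (q^(7-4)) (q^7) * qpoch_inf (q^7) (q^7) / qpoch_inf (q^2) (q^2))) UNIV"
    by (subst (asm) has_sum_int_nonneg) (simp_all only: e0 selbergA_neg mult_zero_right)
  thus ?th1 unfolding selbergA_0[OF q] by (simp add: mult_ac)
  have "((\<lambda>n. (q^2) powi (n * (n + 1)) * selbergB q (-1) n) has_sum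
           (qpoch_inf (q^5) (q^7) * qpoch_inf (q^(7-5)) (q^7) * qpoch_inf (q^7) (q^7) / qpoch_inf (q^2) (q^2))) UNIV"
    using selbergB_has_sum[of q "-1"]
    by (intro bailey_transform[OF q2 pent_wt_norm_summable[OF q, of "-1"]] square_powi_norm_summable
              pent_wt_theta_has_sum q) auto
  hence "((\<lambda>n. q ^ (2 * n^2 + 2 * n) * selbergB q (-1) (int n)) has_sum
           (qpoch_inf (q^5) (q^7) * qpoch_inf (q^(7-5)) (q^7) * qpoch_inf (q^7) (q^7) / qpoch_inf (q^2) (q^2))) UNIV"
    by (subst (asm) has_sum_int_nonneg) (simp_all only: e1 selbergB_neg mult_zero_right)
  thus ?th2 unfolding selbergB_minus_1_selbergA_0[OF q] selbergA_0[OF q] by (simp add: mult_ac)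
  have "((\<lambda>n. (q^2) powi (n * (n + 1)) * selbergB q 0 n) has_sum
           (qpoch_inf (q^6) (q^7) * qpoch_inf (q^(7-6)) (q^7) * qpoch_inf (q^7) (q^7) / qpoch_inf (q^2) (q^2))) UNIV"
    using selbergB_has_sum[of q 0]
    by (intro bailey_transform[OF q2 pent_wt_norm_summable[OF q, of 0]] square_powi_norm_summable
              pent_wt_theta_has_sum q) auto
  hence "((\<lambda>n. q ^ (2 * n^2 + 2 * n) * selbergB q 0 (int n)) has_sum
           (qpoch_inf (q^6) (q^7) * qpoch_inf (q^(7-6)) (q^7) * qpoch_inf (q^7) (q^7) / qpoch_inf (q^2) (q^2))) UNIV"
    by (subst (asm) has_sum_int_nonneg) (simp_all only: e1 selbergB_neg mult_zero_right)
  thus ?th3 unfolding selbergB_0[OF q] by (simp add: mult_ac)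
qed

section \<open>The triple sums\<close>

text \<open>Euler's expansion in base \<open>q^2\<close> at \<open>x = q^(b+1)\<close>, using
  \<open>2 * (j choose 2) + j = j^2\<close>.\<close>

lemma euler_square_has_sum:
  assumes "norm q < 1"
  shows "((\<lambda>j. q ^ (j^2 + b * j) / qpoch (q^2) (q^2) j) has_sum qpoch_inf (- (q ^ (b + 1))) (q^2)) UNIV"
proof -
  have q2: "norm (q^2) < 1"
    using assms by (simp add: norm_power power_less_one_iff)
  have "((\<lambda>j. euler_coeff (q^2) j * (q ^ (b + 1)) ^ j) has_sum qpoch_inf (- (q ^ (b + 1))) (q^2)) UNIV"
    using summable_norm_euler[OF q2] euler_sums[OF q2] by (simp add: has_sum_sums_iff)
  moreover have "euler_coeff (q^2) j * (q ^ (b + 1)) ^ j = q ^ (j^2 + b * j) / qpoch (q^2) (q^2) j" for j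
  proof -
    have "2 * (j choose 2) + j = j^2"
      by (induction j) (auto simp: numeral_2_eq_2)
    hence "2 * (j choose 2) + (b + 1) * j = j^2 + b * j" by (simp add: algebra_simps)
    hence "(q^2) ^ (j choose 2) * (q ^ (b + 1)) ^ j = q ^ (j^2 + b * j)"
      by (metis power_add power_mult)
    thus ?thesis by (simp add: euler_coeff_def)
  qed
  ultimately show ?thesis by simp
qed

lemma norm_summable_power_over_qpoch:
  assumes "norm q < 1"
  shows "(\<lambda>i. norm (q ^ i / qpoch (q^2) (q^2) i)) summable_on UNIV"
proof -
  have q2: "norm (q^2) < 1"
    using assms by (simp add: norm_power power_less_one_iff)
  obtain C where C: "C > 0" "\<And>n. norm (1 / qpoch (q^2) (q^2) n) \<le> C"
    using inverse_qpoch_bounded[OF q2] by blast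
  have "summable (\<lambda>i. norm (q ^ i / qpoch (q^2) (q^2) i))"
  proof (rule summable_comparison_test'[where N = 0])
    show "summable (\<lambda>i. norm q ^ i * C)"
      using assms by (intro summable_mult2 summable_geometric) auto
    fix i :: nat
    have "norm (q ^ i / qpoch (q^2) (q^2) i) = norm q ^ i * norm (1 / qpoch (q^2) (q^2) i)"
      by (simp add: norm_divide norm_power)
    also have "\<dots> \<le> norm q ^ i * C"
      using C by (intro mult_left_mono) auto
    finally show "norm (norm (q ^ i / qpoch (q^2) (q^2) i)) \<le> norm q ^ i * C" by simp
  qed
  thus ?thesis by (simp only: summable_on_nat_norm_iff)
qed

text \<open>For fixed \<open>i\<close> the exponent separates in \<open>j\<close> and
  \<open>k\<close> with linear coefficients \<open>2i + b\<close> and \<open>2i + c\<close>, so each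
  sum is an Euler expansion.\<close>

lemma triple_has_sum:
  assumes q: "norm q < 1"
    and S: "((\<lambda>i. q ^ (2 * i^2 + a * i) / qpoch (q^2) (q^2) i *
              (qpoch_inf (- (q ^ (2 * i + b + 1))) (q^2) * qpoch_inf (- (q ^ (2 * i + c + 1))) (q^2)))
             has_sum S) UNIV"
  shows "((\<lambda>(i, j, k). q ^ (2*i^2 + j^2 + k^2 + 2*i*j + 2*i*k + a*i + b*j + c*k) /
            (qpoch (q^2) (q^2) i * qpoch (q^2) (q^2) j * qpoch (q^2) (q^2) k)) has_sum S)
         (UNIV :: (nat \<times> nat \<times> nat) set)"
proof -
  define P where "P = qpoch (q^2) (q^2)"
  define h where "h i = q ^ i / P i" for i
  define F where "F = (\<lambda>(i, j, k). q ^ (2*i^2 + j^2 + k^2 + 2*i*j + 2*i*k + a*i + b*j + c*k) / (P i * P j * P k))"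
  have h: "(\<lambda>i. norm (h i)) summable_on UNIV"
    unfolding h_def P_def by (rule norm_summable_power_over_qpoch[OF q])
  have "(\<lambda>p. norm (h (fst p) * (\<lambda>r. h (fst r) * h (snd r)) (snd p))) summable_on UNIV \<times> (UNIV \<times> UNIV)"
    by (intro summable_on_norm_mult_Times h)
  hence "(\<lambda>p. norm (F p)) summable_on UNIV \<times> (UNIV \<times> UNIV)"
  proof (rule summable_on_comparison_test)
    fix p :: "nat \<times> nat \<times> nat"
    obtain i j k where p: "p = (i, j, k)" by (cases p)
    have sq: "n \<le> n^2" for n :: nat by (cases n) (auto simp: power2_eq_square)
    \<comment> \<open>Since each square dominates its root, the triple family is bounded by a
      product of three absolutely summable ones.\<close>
    have "i + j + k \<le> 2*i^2 + j^2 + k^2 + 2*i*j + 2*i*k + a*i + b*j + c*k"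
      using sq[of i] sq[of j] sq[of k] by linarith
    hence "norm q ^ (2*i^2 + j^2 + k^2 + 2*i*j + 2*i*k + a*i + b*j + c*k) \<le> norm q ^ (i + j + k)"
      using q by (intro power_decreasing) auto
    hence "norm (F p) \<le> norm q ^ (i + j + k) / norm (P i * P j * P k)"
      unfolding p F_def by (simp add: norm_divide norm_power divide_right_mono)
    also have "\<dots> = norm (h i * (h j * h k))"
      by (simp add: h_def norm_divide norm_mult norm_power power_add)
    finally show "norm (F p) \<le> norm (h (fst p) * (\<lambda>r. h (fst r) * h (snd r)) (snd p))"
      by (simp add: p)
  qed auto
  hence summable: "F summable_on UNIV \<times> (UNIV \<times> UNIV)"
    by (rule abs_summable_summable)
  have "(F has_sum S) (UNIV \<times> (UNIV \<times> UNIV))"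
  proof (rule has_sum_SigmaI[OF _ S summable])
    fix i :: nat
    define f where "f b j = q ^ (j^2 + (2 * i + b) * j) / P j" for b j
    have f: "(f b has_sum qpoch_inf (- (q ^ (2 * i + b + 1))) (q^2)) UNIV" for b
      unfolding f_def P_def by (rule euler_square_has_sum[OF q])
    hence f': "(\<lambda>j. norm (f b j)) summable_on UNIV" for b
      by (subst summable_on_iff_abs_summable_on_complex[symmetric]) (auto simp: summable_on_def)
    have "F (i, p) = q ^ (2 * i^2 + a * i) / P i * (f b (fst p) * f c (snd p))" for p
    proof (cases p)
      case (Pair j k)
      have e: "2*i^2 + j^2 + k^2 + 2*i*j + 2*i*k + a*i + b*j + c*k
              = (2 * i^2 + a * i) + ((j^2 + (2 * i + b) * j) + (k^2 + (2 * i + c) * k))"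
        by (simp add: algebra_simps)
      show ?thesis unfolding Pair F_def f_def prod.case fst_conv snd_conv e
        by (simp only: power_add times_divide_times_eq mult.assoc)
    qed
    thus "((\<lambda>p. F (i, p)) has_sum q ^ (2 * i^2 + a * i) / qpoch (q^2) (q^2) i *
              (qpoch_inf (- (q ^ (2 * i + b + 1))) (q^2) * qpoch_inf (- (q ^ (2 * i + c + 1))) (q^2))) (UNIV \<times> UNIV)"
      using has_sum_cmult_right[OF has_sum_mult_Times[OF f' f' f f, of b c], of "q ^ (2 * i^2 + a * i) / P i"]
      by (simp add: P_def)
  qed
  thus ?thesis by (simp add: F_def P_def)
qed

text \<open>The two products in base \<open>q^2\<close> interlace to
  \<open>(-q^(n+1);q)_inf\<close>, a tail of \<open>(-q;q)_inf\<close>.\<close>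

lemma qpoch_inf_uminus_power:
  assumes "norm q < 1"
  shows "qpoch_inf (- (q ^ (n + 1))) (q^2) * qpoch_inf (- (q ^ (n + 2))) (q^2)
           = qpoch_inf (-q) q / qpoch (-q) q n"
proof -
  have "qpoch_inf (- (q ^ (n + 1))) (q^2) * qpoch_inf (- (q ^ (n + 2))) (q^2) = qpoch_inf (- (q ^ (n + 1))) q"
    using qpoch_inf_square_split[OF assms, of "- (q ^ (n + 1))"] by (simp add: mult_ac)
  also have "\<dots> = qpoch_inf (-q) q / qpoch (-q) q n"
    using qpoch_inf_split[OF assms, of "-q" n] qpoch_uminus_self_neq_0[OF assms, of n] by simp
  finally show ?thesis .
qed

text \<open>Follows from \<open>(q;q)_inf * (-q;q)_inf = (q^2;q^2)_inf\<close>.\<close>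

lemma qpoch_inf_uminus_cancel:
  assumes "norm q < 1"
  shows "qpoch_inf (-q) q * (T / qpoch_inf (q^2) (q^2)) = T / qpoch_inf q q"
proof -
  have "norm (q^2) < 1"
    using assms by (simp add: norm_power power_less_one_iff)
  hence "qpoch_inf q q * qpoch_inf (-q) q \<noteq> 0"
    using qpoch_inf_self_neq_0[of "q^2"] qpoch_inf_uminus[OF assms, of q] by simp
  thus ?thesis unfolding qpoch_inf_uminus[OF assms, symmetric] by simp
qed

lemma has_sum_only_origin:
  fixes f :: "nat \<times> nat \<times> nat \<Rightarrow> complex"
  assumes "\<And>p. p \<noteq> (0, 0, 0) \<Longrightarrow> f p = 0" "f (0, 0, 0) = S"
  shows "(f has_sum S) UNIV"
proof -
  have "(f has_sum S) {(0, 0, 0)}"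
    using has_sum_finite[of "{(0, 0, 0)}" f] assms(2) by simp
  thus ?thesis
    by (rule has_sum_cong_neutral[THEN iffD1, rotated -1]) (use assms(1) in auto)
qed

lemma qpoch_inf_0 [simp]: "qpoch_inf 0 q = 1"
  by (simp add: qpoch_inf_def)

theorem theorem4p5:
  fixes q :: complex
  assumes "norm q < 1"
  shows
   "(((\<lambda>(i, j, k). q ^ (2*i^2 + j^2 + k^2 + 2*i*j + 2*i*k + k) /
        (qpoch (q^2) (q^2) i * qpoch (q^2) (q^2) j * qpoch (q^2) (q^2) k))
      has_sum (qpoch_inf (q^3) (q^7) * qpoch_inf (q^4) (q^7) * qpoch_inf (q^7) (q^7)
               / qpoch_inf q q)) (UNIV :: (nat \<times> nat \<times> nat) set))
   \<and>
   (((\<lambda>(i, j, k). q ^ (2*i^2 + j^2 + k^2 + 2*i*j + 2*i*k + 2*i + j) /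
        (qpoch (q^2) (q^2) i * qpoch (q^2) (q^2) j * qpoch (q^2) (q^2) k))
      has_sum (qpoch_inf (q^2) (q^7) * qpoch_inf (q^5) (q^7) * qpoch_inf (q^7) (q^7)
               / qpoch_inf q q)) (UNIV :: (nat \<times> nat \<times> nat) set))
   \<and>
   (((\<lambda>(i, j, k). q ^ (2*i^2 + j^2 + k^2 + 2*i*j + 2*i*k + 2*i + j + 2*k) /
        (qpoch (q^2) (q^2) i * qpoch (q^2) (q^2) j * qpoch (q^2) (q^2) k))
      has_sum (qpoch_inf q (q^7) * qpoch_inf (q^6) (q^7) * qpoch_inf (q^7) (q^7)
               / qpoch_inf q q)) (UNIV :: (nat \<times> nat \<times> nat) set))"
proof (cases "q = 0")
  case True
  \<comment> \<open>At \<open>q = 0\<close> only the term with exponent 0 survives, and each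
    exponent vanishes only at the origin.\<close>
  show ?thesis
    unfolding True by (intro conjI has_sum_only_origin) (auto simp: power_0_left split: if_splits)
next
  case False
  note q = assms False
  show ?thesis
  proof (intro conjI)
    \<comment> \<open>Linear coefficients \<open>(a, b, c) = (0, 0, 1)\<close>: the Euler products
      of \<open>j\<close> and \<open>k\<close> start at consecutive powers of
      \<open>q\<close>.\<close>
    have eq: "qpoch_inf (-q) q * (q ^ (2 * i^2) / (qpoch (q^2) (q^2) i * qpoch (-q) q (2 * i)))
       = q ^ (2 * i^2 + 0 * i) / qpoch (q^2) (q^2) i *
         (qpoch_inf (- (q ^ (2 * i + 0 + 1))) (q^2) * qpoch_inf (- (q ^ (2 * i + 1 + 1))) (q^2))" for i
      using qpoch_inf_uminus_power[OF q(1), of "2 * i"] by (simp add: numeral_2_eq_2)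
    from triple_has_sum[OF q(1) has_sum_cmult_right[OF rogers_selberg(1)[OF q], of "qpoch_inf (-q) q", unfolded eq qpoch_inf_uminus_cancel[OF q(1)]]]
    show "((\<lambda>(i, j, k). q ^ (2*i^2 + j^2 + k^2 + 2*i*j + 2*i*k + k) /
        (qpoch (q^2) (q^2) i * qpoch (q^2) (q^2) j * qpoch (q^2) (q^2) k))
      has_sum (qpoch_inf (q^3) (q^7) * qpoch_inf (q^4) (q^7) * qpoch_inf (q^7) (q^7)
               / qpoch_inf q q)) (UNIV :: (nat \<times> nat \<times> nat) set)" by simp
  next
    \<comment> \<open>Here \<open>(a, b, c) = (2, 1, 0)\<close>, with the roles of \<open>j\<close>
      and \<open>k\<close> exchanged.\<close>
    have eq: "qpoch_inf (-q) q * (q ^ (2 * i^2 + 2 * i) / (qpoch (q^2) (q^2) i * qpoch (-q) q (2 * i)))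
       = q ^ (2 * i^2 + 2 * i) / qpoch (q^2) (q^2) i *
         (qpoch_inf (- (q ^ (2 * i + 1 + 1))) (q^2) * qpoch_inf (- (q ^ (2 * i + 0 + 1))) (q^2))" for i
      using qpoch_inf_uminus_power[OF q(1), of "2 * i"] by (simp add: numeral_2_eq_2 mult_ac)
    from triple_has_sum[OF q(1) has_sum_cmult_right[OF rogers_selberg(2)[OF q], of "qpoch_inf (-q) q", unfolded eq qpoch_inf_uminus_cancel[OF q(1)]]]
    show "((\<lambda>(i, j, k). q ^ (2*i^2 + j^2 + k^2 + 2*i*j + 2*i*k + 2*i + j) /
        (qpoch (q^2) (q^2) i * qpoch (q^2) (q^2) j * qpoch (q^2) (q^2) k))
      has_sum (qpoch_inf (q^2) (q^7) * qpoch_inf (q^5) (q^7) * qpoch_inf (q^7) (q^7)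
               / qpoch_inf q q)) (UNIV :: (nat \<times> nat \<times> nat) set)" by simp
  next
    \<comment> \<open>Here \<open>(a, b, c) = (2, 1, 2)\<close>: both products start one power later
      than in the first sum, so the finite factor has length \<open>2i + 1\<close>.\<close>
    have eq: "qpoch_inf (-q) q * (q ^ (2 * i^2 + 2 * i) / (qpoch (q^2) (q^2) i * qpoch (-q) q (2 * i + 1)))
       = q ^ (2 * i^2 + 2 * i) / qpoch (q^2) (q^2) i *
         (qpoch_inf (- (q ^ (2 * i + 1 + 1))) (q^2) * qpoch_inf (- (q ^ (2 * i + 2 + 1))) (q^2))" for i
      using qpoch_inf_uminus_power[OF q(1), of "2 * i + 1"] by (simp add: numeral_2_eq_2)
    from triple_has_sum[OF q(1) has_sum_cmult_right[OF rogers_selberg(3)[OF q], of "qpoch_inf (-q) q", unfolded eq qpoch_inf_uminus_cancel[OF q(1)]]]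
    show "((\<lambda>(i, j, k). q ^ (2*i^2 + j^2 + k^2 + 2*i*j + 2*i*k + 2*i + j + 2*k) /
        (qpoch (q^2) (q^2) i * qpoch (q^2) (q^2) j * qpoch (q^2) (q^2) k))
      has_sum (qpoch_inf q (q^7) * qpoch_inf (q^6) (q^7) * qpoch_inf (q^7) (q^7)
               / qpoch_inf q q)) (UNIV :: (nat \<times> nat \<times> nat) set)" by simp
  qed
qed

end
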